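(* On a Hermitian manifold $(X,J,g)$, in local holomorphic coordinates, the following formula holds: $$Q_{i\bar jk\bar l}=B_{k\bar li\bar j}+\partial_{\bar l}T_{ik\bar j}-\partial_{\bar j}T_{ik\bar l},$$ where $B_{k\bar li\bar j}$ is the $(1,1)$-part of the curvature of the Bismut connection.
   Context: In local holomorphic coordinates $\omega=\sum g_{i\bar j}\sqrt{-1}\,dz^i\wedge d\bar z^j$; repeated indices are summed and $g^{i\bar j}$ is the inverse matrix. Chern connection coefficients: $\Gamma_{ki}^j=g^{j\bar m}\partial_kg_{i\bar m}$. Torsion: $T_{ij}^k=\Gamma_{ij}^k-\Gamma_{ji}^k$, $T_{ij\bar k}=g_{m\bar k}T_{ij}^m=\partial_ig_{j\bar k}-\partial_jg_{i\bar k}$. Curvature: $R_{i\bar jk}{}^{l}=-\partial_{\bar j}\Gamma_{ik}^l$, $R_{i\bar jk\bar l}=g_{m\bar l}R_{i\bar jk}{}^{m}$. The tensor $Q$ is $Q_{i\bar jk\bar l}=R_{i\bar jk\bar l}-g^{p\bar q}T_{kp\bar j}\overline{T_{lq\bar i}}$. Bismut connection on $T^{1,0}X$: $\nabla^+_iX^j=\partial_iX^j+\mathcal{A}_{il}^jX^l$, $\nabla^+_{\bar i}X^j=\partial_{\bar i}X^j+\mathcal{A}_{\bar il}^jX^l$, with $\mathcal{A}_{il}^j=\Gamma_{li}^j$ and $\mathcal{A}_{\bar il}^j=g^{j\bar m}\overline{T_{im\bar l}}$. The $(1,1)$-part of its curvature is $B_{i\bar jm}{}^{k}=\partial_i\mathcal{A}_{\bar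 jm}^k-\partial_{\bar j}\mathcal{A}_{im}^k+\mathcal{A}_{il}^k\mathcal{A}_{\bar jm}^l-\mathcal{A}_{\bar jl}^k\mathcal{A}_{im}^l$, and $B_{i\bar jk\bar l}=g_{m\bar l}B_{i\bar jk}{}^{m}$. *)

theory Defs
  imports "HOL-Analysis.Analysis"
begin

text \<open>Smoothness is real \<open>C\<^sup>\<infinity>\<close> smoothness; it is meant for open sets in a
  finite-dimensional space, where existence and continuity of all iterated directional
  derivatives is the usual notion.\<close>

primrec Ck_on :: "nat \<Rightarrow> ('a::real_normed_vector \<Rightarrow> 'b::real_normed_vector) \<Rightarrow> 'a set \<Rightarrow> bool" where
  "Ck_on 0 f S \<longleftrightarrow> continuous_on S f"
| "Ck_on (Suc k) f S \<longleftrightarrow>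
     (\<forall>x\<in>S. f differentiable (at x)) \<and> (\<forall>v. Ck_on k (\<lambda>x. frechet_derivative f (at x) v) S)"

definition smooth_on :: "('a::real_normed_vector \<Rightarrow> 'b::real_normed_vector) \<Rightarrow> 'a set \<Rightarrow> bool" where
  "smooth_on f S \<longleftrightarrow> (\<forall>k. Ck_on k f S)"

definition holomorphic_map_on :: "(complex^'n \<Rightarrow> complex^'m) \<Rightarrow> (complex^'n) set \<Rightarrow> bool" where
  "holomorphic_map_on f S \<longleftrightarrow>
     (\<forall>z\<in>S. \<exists>D. (f has_derivative D) (at z) \<and> (\<forall>c v. D (c *s v) = c *s D v))"

text \<open>The Wirtinger operators \<open>\<partial>\<^sub>i = (\<partial>/\<partial>x\<^sup>i - \<i> \<partial>/\<partial>y\<^sup>i)/2\<close> and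
  \<open>\<partial>\<^sub>i\<^sub>b\<^sub>a\<^sub>r = (\<partial>/\<partial>x\<^sup>i + \<i> \<partial>/\<partial>y\<^sup>i)/2\<close>, where \<open>z\<^sup>i = x\<^sup>i + \<i> y\<^sup>i\<close>.\<close>

definition dz :: "'n \<Rightarrow> (complex^'n \<Rightarrow> complex) \<Rightarrow> complex^'n \<Rightarrow> complex" where
  "dz i f z = (frechet_derivative f (at z) (axis i 1) - \<i> * frechet_derivative f (at z) (axis i \<i>)) / 2"

definition dzbar :: "'n \<Rightarrow> (complex^'n \<Rightarrow> complex) \<Rightarrow> complex^'n \<Rightarrow> complex" where
  "dzbar i f z = (frechet_derivative f (at z) (axis i 1) + \<i> * frechet_derivative f (at z) (axis i \<i>)) / 2"

section \<open>Hermitian manifolds\<close>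

text \<open>The underlying space of the manifold is a whole Hausdorff, second countable type \<open>'p\<close>,
  and the complex structure \<open>J\<close> is given by an atlas with holomorphic transition maps.
  The atlas need not be maximal; taking it maximal gives all local holomorphic coordinates.\<close>

type_synonym ('p, 'n) chart = "'p set \<times> ('p \<Rightarrow> complex^'n)"

definition transition :: "('p, 'n::finite) chart \<Rightarrow> ('p, 'n) chart \<Rightarrow> complex^'n \<Rightarrow> complex^'n" where
  "transition c d = snd d \<circ> inv_into (fst c) (snd c)"

definition complex_manifold ::
    "('p::{t2_space,second_countable_topology}, 'n::finite) chart set \<Rightarrow> bool" where
  "complex_manifold \<A> \<longleftrightarrow>
     \<Union> (fst ` \<A>) = UNIV \<and>
     (\<forall>(U, \<phi>)\<in>\<A>. open U \<and> open (\<phi> ` U) \<and> homeomorphism U (\<phi> ` U) \<phi> (inv_into U \<phi>)) \<and>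
     (\<forall>c\<in>\<A>. \<forall>d\<in>\<A>. holomorphic_map_on (transition c d) (snd c ` (fst c \<inter> fst d)))"

text \<open>A Hermitian metric is given by the coefficients of its fundamental form
  \<open>\<omega> = \<i> g\<^sub>i\<^sub>j dz\<^sup>i \<and> d(cnj z\<^sup>j)\<close> in every chart \<open>c\<close>: \<open>g c z $ i $ j\<close> is
  the coefficient at the point with coordinates \<open>z\<close>; the second index is the barred one.
  The last clause says that the \<open>g c\<close> represent one global tensor.\<close>

definition positive_hermitian :: "complex^'n^'n \<Rightarrow> bool" where
  "positive_hermitian H \<longleftrightarrow>
     (\<forall>i j. H $ i $ j = cnj (H $ j $ i)) \<and>
     (\<forall>v. v \<noteq> 0 \<longrightarrow> Re (\<Sum>i\<in>UNIV. \<Sum>j\<in>UNIV. H $ i $ j * v $ i * cnj (v $ j)) > 0)"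

definition hermitian_metric ::
    "('p::{t2_space,second_countable_topology}, 'n::finite) chart set \<Rightarrow>
     (('p, 'n) chart \<Rightarrow> complex^'n \<Rightarrow> complex^'n^'n) \<Rightarrow> bool" where
  "hermitian_metric \<A> g \<longleftrightarrow>
     (\<forall>c\<in>\<A>. smooth_on (g c) (snd c ` fst c) \<and> (\<forall>z\<in>snd c ` fst c. positive_hermitian (g c z))) \<and>
     (\<forall>c\<in>\<A>. \<forall>d\<in>\<A>. \<forall>p\<in>fst c \<inter> fst d. \<forall>i j.
        g c (snd c p) $ i $ j =
          (\<Sum>a\<in>UNIV. \<Sum>b\<in>UNIV. g d (snd d p) $ a $ b
             * dz i (\<lambda>z. transition c d z $ a) (snd c p)
             * cnj (dz j (\<lambda>z. transition c d z $ b) (snd c p))))"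

definition hermitian_manifold ::
    "('p::{t2_space,second_countable_topology}, 'n::finite) chart set \<Rightarrow>
     (('p, 'n) chart \<Rightarrow> complex^'n \<Rightarrow> complex^'n^'n) \<Rightarrow> bool" where
  "hermitian_manifold \<A> g \<longleftrightarrow> complex_manifold \<A> \<and> hermitian_metric \<A> g"

section \<open>Tensors in local holomorphic coordinates\<close>

text \<open>From here on \<open>g\<close> is the coefficient matrix of the metric in one chart. Indices are taken
  in the order in which they are written in classical notation, lower before upper; a bar
  on an index has to be read off from the comments or the use of \<open>dzbar\<close> and \<open>cnj\<close>.\<close>

type_synonym 'n metric_coeffs = "complex^'n \<Rightarrow> complex^'n^'n"

text \<open>\<open>g_inv g i j\<close> is \<open>g\<^sup>i\<^sup>j\<close> with \<open>j\<close> barred, normalised by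
  \<open>g\<^sup>i\<^sup>j g\<^sub>k\<^sub>j = \<delta>\<^sup>i\<^sub>k\<close>, hence the transposed indices.\<close>

definition g_inv :: "'n::finite metric_coeffs \<Rightarrow> 'n \<Rightarrow> 'n \<Rightarrow> complex^'n \<Rightarrow> complex" where
  "g_inv g i j z = matrix_inv (g z) $ j $ i"

text \<open>\<open>chern_Gamma g k i j\<close> is \<open>\<Gamma>\<^sub>k\<^sub>i\<^sup>j\<close>.\<close>

definition chern_Gamma :: "'n::finite metric_coeffs \<Rightarrow> 'n \<Rightarrow> 'n \<Rightarrow> 'n \<Rightarrow> complex^'n \<Rightarrow> complex" where
  "chern_Gamma g k i j z = (\<Sum>m\<in>UNIV. g_inv g j m z * dz k (\<lambda>w. g w $ i $ m) z)"

text \<open>\<open>torsion g i j k\<close> is \<open>T\<^sub>i\<^sub>j\<^sup>k\<close>, and \<open>torsion_low g i j k\<close> is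
  \<open>T\<^sub>i\<^sub>j\<^sub>k\<close> with \<open>k\<close> barred.\<close>

definition torsion :: "'n::finite metric_coeffs \<Rightarrow> 'n \<Rightarrow> 'n \<Rightarrow> 'n \<Rightarrow> complex^'n \<Rightarrow> complex" where
  "torsion g i j k z = chern_Gamma g i j k z - chern_Gamma g j i k z"

definition torsion_low :: "'n::finite metric_coeffs \<Rightarrow> 'n \<Rightarrow> 'n \<Rightarrow> 'n \<Rightarrow> complex^'n \<Rightarrow> complex" where
  "torsion_low g i j k z = (\<Sum>m\<in>UNIV. g z $ m $ k * torsion g i j m z)"

text \<open>In the curvature tensors and in \<open>Q\<close> the second index is barred, and so is the fourth
  one when it is lowered.\<close>

definition chern_curv :: "'n::finite metric_coeffs \<Rightarrow> 'n \<Rightarrow> 'n \<Rightarrow> 'n \<Rightarrow> 'n \<Rightarrow> complex^'n \<Rightarrow> complex" where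
  "chern_curv g i j k l z = - dzbar j (chern_Gamma g i k l) z"

definition chern_curv_low :: "'n::finite metric_coeffs \<Rightarrow> 'n \<Rightarrow> 'n \<Rightarrow> 'n \<Rightarrow> 'n \<Rightarrow> complex^'n \<Rightarrow> complex" where
  "chern_curv_low g i j k l z = (\<Sum>m\<in>UNIV. g z $ m $ l * chern_curv g i j k m z)"

definition Q_tensor :: "'n::finite metric_coeffs \<Rightarrow> 'n \<Rightarrow> 'n \<Rightarrow> 'n \<Rightarrow> 'n \<Rightarrow> complex^'n \<Rightarrow> complex" where
  "Q_tensor g i j k l z = chern_curv_low g i j k l z
     - (\<Sum>p\<in>UNIV. \<Sum>q\<in>UNIV. g_inv g p q z * torsion_low g k p j z * cnj (torsion_low g l q i z))"

text \<open>A connection \<open>\<nabla>\<close> on \<open>T\<^sup>1\<^sup>,\<^sup>0X\<close> is given by its coefficients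
  \<open>A i l j = A\<^sub>i\<^sub>l\<^sup>j\<close> in the directions \<open>\<partial>\<^sub>i\<close> and \<open>Abar i l j\<close> in the conjugate
  directions, so that \<open>\<nabla>\<^sub>iX\<^sup>j = \<partial>\<^sub>iX\<^sup>j + A\<^sub>i\<^sub>l\<^sup>jX\<^sup>l\<close>, and likewise for \<open>Abar\<close>.
  \<open>curv11 A Abar i j m k\<close> is the coefficient at \<open>\<partial>\<^sub>k\<close> of the commutator of \<open>\<nabla>\<^sub>i\<close>
  and \<open>\<nabla>\<^sub>j\<close> (\<open>j\<close> barred) applied to \<open>\<partial>\<^sub>m\<close>.\<close>

definition nabla :: "('n::finite \<Rightarrow> 'n \<Rightarrow> 'n \<Rightarrow> complex^'n \<Rightarrow> complex) \<Rightarrow>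
    'n \<Rightarrow> (complex^'n \<Rightarrow> complex^'n) \<Rightarrow> complex^'n \<Rightarrow> complex^'n" where
  "nabla A i X z = (\<chi> j. dz i (\<lambda>w. X w $ j) z + (\<Sum>l\<in>UNIV. A i l j z * X z $ l))"

definition nabla_bar :: "('n::finite \<Rightarrow> 'n \<Rightarrow> 'n \<Rightarrow> complex^'n \<Rightarrow> complex) \<Rightarrow>
    'n \<Rightarrow> (complex^'n \<Rightarrow> complex^'n) \<Rightarrow> complex^'n \<Rightarrow> complex^'n" where
  "nabla_bar Abar i X z = (\<chi> j. dzbar i (\<lambda>w. X w $ j) z + (\<Sum>l\<in>UNIV. Abar i l j z * X z $ l))"

definition curv11 :: "('n::finite \<Rightarrow> 'n \<Rightarrow> 'n \<Rightarrow> complex^'n \<Rightarrow> complex) \<Rightarrow>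
    ('n \<Rightarrow> 'n \<Rightarrow> 'n \<Rightarrow> complex^'n \<Rightarrow> complex) \<Rightarrow>
    'n \<Rightarrow> 'n \<Rightarrow> 'n \<Rightarrow> 'n \<Rightarrow> complex^'n \<Rightarrow> complex" where
  "curv11 A Abar i j m k z = dz i (Abar j m k) z - dzbar j (A i m k) z
     + (\<Sum>l\<in>UNIV. A i l k z * Abar j m l z) - (\<Sum>l\<in>UNIV. Abar j l k z * A i m l z)"

lemma dz_const [simp]: "dz i (\<lambda>w. c) z = 0" and dzbar_const [simp]: "dzbar i (\<lambda>w. c) z = 0"
  by (simp_all add: dz_def dzbar_def)

lemma curv11_eq_commutator:
  "curv11 A Abar i j m k z =
     (nabla A i (nabla_bar Abar j (\<lambda>_. axis m 1)) z
      - nabla_bar Abar j (nabla A i (\<lambda>_. axis m 1)) z) $ k"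
  by (simp add: curv11_def nabla_def nabla_bar_def axis_def if_distrib sum.delta cong: if_cong)

definition bismut_A :: "'n::finite metric_coeffs \<Rightarrow> 'n \<Rightarrow> 'n \<Rightarrow> 'n \<Rightarrow> complex^'n \<Rightarrow> complex" where
  "bismut_A g i l j = chern_Gamma g l i j"

definition bismut_Abar :: "'n::finite metric_coeffs \<Rightarrow> 'n \<Rightarrow> 'n \<Rightarrow> 'n \<Rightarrow> complex^'n \<Rightarrow> complex" where
  "bismut_Abar g i l j z = (\<Sum>m\<in>UNIV. g_inv g j m z * cnj (torsion_low g i m l z))"

definition bismut_curv :: "'n::finite metric_coeffs \<Rightarrow> 'n \<Rightarrow> 'n \<Rightarrow> 'n \<Rightarrow> 'n \<Rightarrow> complex^'n \<Rightarrow> complex" where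
  "bismut_curv g = curv11 (bismut_A g) (bismut_Abar g)"

definition bismut_curv_low :: "'n::finite metric_coeffs \<Rightarrow> 'n \<Rightarrow> 'n \<Rightarrow> 'n \<Rightarrow> 'n \<Rightarrow> complex^'n \<Rightarrow> complex" where
  "bismut_curv_low g i j k l z = (\<Sum>m\<in>UNIV. g z $ m $ l * bismut_curv g i j k m z)"

end

theory Submission
  imports Defs
begin

text \<open>Lowering an index by \<open>g\<close> turns the Chern coefficients into \<open>\<partial>\<^sub>ig\<^sub>k\<^sub>l\<close> and the barred
  Bismut coefficients into the conjugate torsion, so the product rule expresses both curvature
  tensors, with lowered indices, through second derivatives of \<open>g\<close> and products of first
  derivatives with connection coefficients, without derivatives of the inverse matrix. The
  products match those of \<open>Q\<close>, and the second derivatives cancel because mixed partial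
  derivatives commute.\<close>

section \<open>Symmetry of the second derivative\<close>

text \<open>The mean value theorem is used twice: along \<open>u\<close> for the difference of
  \<open>f\<close> over two opposite edges, then along \<open>v\<close>, with the found
  \<open>s\<close> fixed, for the first derivative in direction \<open>u\<close>. Each use
  contributes one factor \<open>h\<close>.\<close>

lemma mixed_difference_mvt:
  fixes f :: "'a::real_normed_vector \<Rightarrow> real"
  assumes h: "0 < h"
    and f': "\<And>s t. \<lbrakk>0 \<le> s; s \<le> h; 0 \<le> t; t \<le> h\<rbrakk> \<Longrightarrow>
      (f has_derivative f' (z + s *\<^sub>R u + t *\<^sub>R v)) (at (z + s *\<^sub>R u + t *\<^sub>R v))"
    and f'': "\<And>s t. \<lbrakk>0 \<le> s; s \<le> h; 0 \<le> t; t \<le> h\<rbrakk> \<Longrightarrow>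
      ((\<lambda>x. f' x u) has_derivative f'' (z + s *\<^sub>R u + t *\<^sub>R v)) (at (z + s *\<^sub>R u + t *\<^sub>R v))"
  shows "\<exists>s t. 0 \<le> s \<and> s \<le> h \<and> 0 \<le> t \<and> t \<le> h \<and>
    f (z + h *\<^sub>R u + h *\<^sub>R v) - f (z + h *\<^sub>R u) - f (z + h *\<^sub>R v) + f z
      = h * h * f'' (z + s *\<^sub>R u + t *\<^sub>R v) v"
proof -
  define p where "p s t = z + s *\<^sub>R u + t *\<^sub>R v" for s t :: real
  have pu: "((\<lambda>s. p s t) has_derivative (\<lambda>r. r *\<^sub>R u)) (at s within X)"
    and pv: "((\<lambda>t. p s t) has_derivative (\<lambda>r. r *\<^sub>R v)) (at t within X)" for s t X
    unfolding p_def by (auto intro!: derivative_eq_intros)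
  have D: "((\<lambda>s. f (p s t)) has_derivative (\<lambda>r. f' (p s t) (r *\<^sub>R u))) (at s within X)"
    if "0 \<le> s" "s \<le> h" "0 \<le> t" "t \<le> h" for s t X
    using has_derivative_compose[OF pu f'[OF that, folded p_def]] .
  have "\<exists>s\<in>{0<..<h}. (f (p h h) - f (p h 0)) - (f (p 0 h) - f (p 0 0))
      = f' (p s h) ((h - 0) *\<^sub>R u) - f' (p s 0) ((h - 0) *\<^sub>R u)"
    by (rule mvt_simple[OF h, where f="\<lambda>s. f (p s h) - f (p s 0)"])
       (use h in \<open>auto intro!: has_derivative_diff D\<close>)
  then obtain s where s: "0 < s" "s < h"
    and 1: "(f (p h h) - f (p h 0)) - (f (p 0 h) - f (p 0 0))
      = f' (p s h) (h *\<^sub>R u) - f' (p s 0) (h *\<^sub>R u)"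
    by auto
  have lin: "f' (p s t) (h *\<^sub>R u) = h * f' (p s t) u" if "0 \<le> t" "t \<le> h" for t
    using linear_scale[OF has_derivative_linear[OF f'[of s t, folded p_def]]] s that by simp
  have "\<exists>t\<in>{0<..<h}. f' (p s h) u - f' (p s 0) u = f'' (p s t) ((h - 0) *\<^sub>R v)"
    by (rule mvt_simple[OF h, where f="\<lambda>t. f' (p s t) u"],
        rule has_derivative_compose[OF pv f''[folded p_def]]) (use s in auto)
  then obtain t where t: "0 < t" "t < h" and 2: "f' (p s h) u - f' (p s 0) u = f'' (p s t) (h *\<^sub>R v)"
    by auto
  have "f'' (p s t) (h *\<^sub>R v) = h * f'' (p s t) v"
    using linear_scale[OF has_derivative_linear[OF f''[of s t, folded p_def]]] s t by simp
  with 1 2 lin[of h] lin[of 0] h have "(f (p h h) - f (p h 0)) - (f (p 0 h) - f (p 0 0))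
      = h * (h * f'' (p s t) v)"
    by (simp add: right_diff_distrib[symmetric])
  then show ?thesis
    using s t by (intro exI[of _ s] exI[of _ t]) (simp add: p_def algebra_simps)
qed

text \<open>The second difference of \<open>f\<close> over a small parallelogram is symmetric in \<open>u\<close> and \<open>v\<close>, and
  the mean value theorem identifies it with either mixed derivative at some nearby point.\<close>

lemma second_derivative_symmetric_real:
  fixes f :: "'a::real_normed_vector \<Rightarrow> real"
  assumes S: "open S" "z \<in> S"
    and f': "\<And>x. x \<in> S \<Longrightarrow> (f has_derivative f' x) (at x)"
    and f'': "\<And>x w. x \<in> S \<Longrightarrow> ((\<lambda>y. f' y w) has_derivative f'' w x) (at x)"
    and cont: "\<And>w w'. continuous_on S (\<lambda>x. f'' w x w')"
  shows "f'' u z v = f'' v z u"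
proof (rule ccontr)
  assume ne: "f'' u z v \<noteq> f'' v z u"
  \<comment> \<open>Half the gap: two numbers strictly within \<open>e\<close> of the two second
    derivatives at \<open>z\<close> cannot coincide.\<close>
  define e where "e = \<bar>f'' u z v - f'' v z u\<bar> / 2"
  have e: "e > 0" using ne by (simp add: e_def)
  have near: "\<exists>d>0. \<forall>x. dist x z < d \<longrightarrow> x \<in> S \<and> \<bar>f'' w x w' - f'' w z w'\<bar> < e" for w w'
  proof -
    have "isCont (\<lambda>x. f'' w x w') z"
      using cont S continuous_on_eq_continuous_at by blast
    then have "((\<lambda>x. f'' w x w') \<longlongrightarrow> f'' w z w') (nhds z)"
      unfolding isCont_def by (rule iffD1[OF tendsto_at_iff_tendsto_nhds])
    then have "\<forall>\<^sub>F x in nhds z. dist (f'' w x w') (f'' w z w') < e"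
      using e by (rule tendstoD)
    moreover have "\<forall>\<^sub>F x in nhds z. x \<in> S"
      using S eventually_nhds by blast
    ultimately have "\<forall>\<^sub>F x in nhds z. dist (f'' w x w') (f'' w z w') < e \<and> x \<in> S"
      by (rule eventually_conj)
    then show ?thesis
      unfolding eventually_nhds_metric dist_real_def by blast
  qed
  obtain d1 d2 where d: "d1 > 0" "d2 > 0"
    and d1: "\<And>x. dist x z < d1 \<Longrightarrow> x \<in> S \<and> \<bar>f'' u x v - f'' u z v\<bar> < e"
    and d2: "\<And>x. dist x z < d2 \<Longrightarrow> x \<in> S \<and> \<bar>f'' v x u - f'' v z u\<bar> < e"
    using near[of u v] near[of v u] by blast
  \<comment> \<open>With this \<open>h\<close> the whole parallelogram lies in both balls. The
    summand 1 keeps the denominator positive for \<open>u = v = 0\<close> and makes the distance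
    bound strict.\<close>
  define h where "h = min d1 d2 / (norm u + norm v + 1)"
  have n: "norm u + norm v + 1 > 0" by (simp add: add_nonneg_pos)
  then have h: "h > 0" using d by (simp add: h_def)
  have close: "dist (z + s *\<^sub>R a + t *\<^sub>R b) z < min d1 d2"
    if "0 \<le> s" "s \<le> h" "0 \<le> t" "t \<le> h" "a = u \<and> b = v \<or> a = v \<and> b = u" for s t a b
  proof -
    have "dist (z + s *\<^sub>R a + t *\<^sub>R b) z \<le> s * norm a + t * norm b"
      using that norm_triangle_ineq[of "s *\<^sub>R a" "t *\<^sub>R b"] by (simp add: dist_norm add.assoc)
    also have "\<dots> \<le> h * norm a + h * norm b"
      using that by (intro add_mono mult_right_mono) auto
    also have "\<dots> < h * (norm u + norm v + 1)"
      using that h by (auto simp: algebra_simps)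
    also have "\<dots> = min d1 d2" using n by (simp add: h_def)
    finally show ?thesis .
  qed
  have inS: "z + s *\<^sub>R a + t *\<^sub>R b \<in> S"
    if "0 \<le> s" "s \<le> h" "0 \<le> t" "t \<le> h" "a = u \<and> b = v \<or> a = v \<and> b = u" for s t a b
    using close[OF that] d1 by simp
  obtain s t where st: "0 \<le> s" "s \<le> h" "0 \<le> t" "t \<le> h"
    and 1: "f (z + h *\<^sub>R u + h *\<^sub>R v) - f (z + h *\<^sub>R u) - f (z + h *\<^sub>R v) + f z
      = h * h * f'' u (z + s *\<^sub>R u + t *\<^sub>R v) v"
    using mixed_difference_mvt[OF h, where z=z and u=u and v=v and f=f and f'=f' and f''="f'' u"]
      f' f'' inS by blast
  obtain s' t' where st': "0 \<le> s'" "s' \<le> h" "0 \<le> t'" "t' \<le> h"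
    and 2: "f (z + h *\<^sub>R v + h *\<^sub>R u) - f (z + h *\<^sub>R v) - f (z + h *\<^sub>R u) + f z
      = h * h * f'' v (z + s' *\<^sub>R v + t' *\<^sub>R u) u"
    using mixed_difference_mvt[OF h, where z=z and u=v and v=u and f=f and f'=f' and f''="f'' v"]
      f' f'' inS by blast
  \<comment> \<open>Both equations evaluate the same second difference, since swapping
    \<open>u\<close> and \<open>v\<close> only permutes its corners.\<close>
  have "h * h * f'' u (z + s *\<^sub>R u + t *\<^sub>R v) v = h * h * f'' v (z + s' *\<^sub>R v + t' *\<^sub>R u) u"
    using 1 2 by (simp add: algebra_simps)
  then have "f'' u (z + s *\<^sub>R u + t *\<^sub>R v) v = f'' v (z + s' *\<^sub>R v + t' *\<^sub>R u) u"
    using h by simp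
  moreover have "\<bar>f'' u (z + s *\<^sub>R u + t *\<^sub>R v) v - f'' u z v\<bar> < e"
    using d1 close[OF st] by simp
  moreover have "\<bar>f'' v (z + s' *\<^sub>R v + t' *\<^sub>R u) u - f'' v z u\<bar> < e"
    using d2 close[OF st'] by simp
  ultimately show False unfolding e_def by (smt (verit) field_sum_of_halves)
qed

text \<open>Pairing with a fixed vector \<open>b\<close> commutes with differentiation and reduces
  to real values; the vectors agree because all their inner products do. This covers complex
  functions, regarded as real differentiable.\<close>

lemma second_derivative_symmetric:
  fixes f :: "'a::real_normed_vector \<Rightarrow> 'b::real_inner"
  assumes S: "open S" "z \<in> S"
    and f': "\<And>x. x \<in> S \<Longrightarrow> (f has_derivative f' x) (at x)"
    and f'': "\<And>x w. x \<in> S \<Longrightarrow> ((\<lambda>y. f' y w) has_derivative f'' w x) (at x)"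
    and cont: "\<And>w w'. continuous_on S (\<lambda>x. f'' w x w')"
  shows "f'' u z v = f'' v z u"
proof -
  have "b \<bullet> f'' u z v = b \<bullet> f'' v z u" for b
    by (rule second_derivative_symmetric_real[OF S, where f="\<lambda>x. b \<bullet> f x"
          and f'="\<lambda>x w. b \<bullet> f' x w" and f''="\<lambda>w x w'. b \<bullet> f'' w x w'"])
       (auto intro!: has_derivative_inner_right f' f'' continuous_intros cont)
  then show ?thesis by (metis inner_eq_zero_iff inner_diff_right right_minus_eq)
qed

section \<open>Wirtinger derivatives\<close>

lemma Ck_on_2D:
  assumes "Ck_on 2 f S"
  shows "\<And>x. x \<in> S \<Longrightarrow> (f has_derivative frechet_derivative f (at x)) (at x)"
    and "\<And>x v. x \<in> S \<Longrightarrow> ((\<lambda>y. frechet_derivative f (at y) v) has_derivative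
           frechet_derivative (\<lambda>y. frechet_derivative f (at y) v) (at x)) (at x)"
    and "\<And>v w. continuous_on S
           (\<lambda>x. frechet_derivative (\<lambda>y. frechet_derivative f (at y) v) (at x) w)"
  using assms by (auto simp: numeral_2_eq_2 frechet_derivative_works[symmetric])

text \<open>A derivative at a point depends on the values nearby, so on an open set agreement passes
  to derivatives. The induction replaces both functions by their derivatives and hence must
  generalise both.\<close>

lemma Ck_on_cong:
  assumes "open S" "\<And>x. x \<in> S \<Longrightarrow> f x = g x" "Ck_on k f S"
  shows "Ck_on k g S"
  using assms(2,3)
proof (induction k arbitrary: f g)
  case 0
  then show ?case using continuous_on_cong[of S S f g] by simp
next
  case (Suc k)
  have D: "(g has_derivative frechet_derivative f (at x)) (at x)" if "x \<in> S" for x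
  proof (rule has_derivative_transform_within_open[OF _ assms(1) that Suc.prems(1)])
    show "(f has_derivative frechet_derivative f (at x)) (at x)"
      using Suc.prems(2) that by (simp add: frechet_derivative_works[symmetric])
  qed
  have "Ck_on k (\<lambda>x. frechet_derivative g (at x) v) S" for v
  proof (rule Suc.IH)
    show "frechet_derivative f (at x) v = frechet_derivative g (at x) v" if "x \<in> S" for x
      by (simp only: frechet_derivative_at[OF D[OF that]])
    show "Ck_on k (\<lambda>x. frechet_derivative f (at x) v) S"
      using Suc.prems(2) by simp
  qed
  moreover have "\<forall>x\<in>S. g differentiable (at x)"
    using D differentiableI by blast
  ultimately show ?case by simp
qed

text \<open>\<open>L\<close> commutes with differentiation. It serves to pass from the matrix-valued
  metric to its entries.\<close>

lemma Ck_on_bounded_linear: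
  assumes "open S" "bounded_linear L" "Ck_on k f S"
  shows "Ck_on k (\<lambda>x. L (f x)) S"
  using assms(3)
proof (induction k arbitrary: f)
  case 0
  then show ?case by (simp add: bounded_linear.continuous_on[OF assms(2)])
next
  case (Suc k)
  have D: "((\<lambda>x. L (f x)) has_derivative (\<lambda>v. L (frechet_derivative f (at x) v))) (at x)"
    if "x \<in> S" for x
    by (rule bounded_linear.has_derivative[OF assms(2)])
       (use Suc.prems that in \<open>simp add: frechet_derivative_works[symmetric]\<close>)
  have "Ck_on k (\<lambda>x. frechet_derivative (\<lambda>x. L (f x)) (at x) v) S" for v
  proof (rule Ck_on_cong[OF assms(1)])
    show "L (frechet_derivative f (at x) v) = frechet_derivative (\<lambda>x. L (f x)) (at x) v"
      if "x \<in> S" for x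
      by (simp only: frechet_derivative_at[OF D[OF that], symmetric])
    show "Ck_on k (\<lambda>x. L (frechet_derivative f (at x) v)) S"
      using Suc.prems by (intro Suc.IH) simp
  qed
  moreover have "\<forall>x\<in>S. (\<lambda>x. L (f x)) differentiable (at x)"
    using D differentiableI by blast
  ultimately show ?case by simp
qed

section \<open>Calculus rules for the Wirtinger operators\<close>

lemma dz_eq: "(f has_derivative f') (at z) \<Longrightarrow> dz i f z = (f' (axis i 1) - \<i> * f' (axis i \<i>)) / 2"
  and dzbar_eq: "(f has_derivative f') (at z) \<Longrightarrow> dzbar i f z = (f' (axis i 1) + \<i> * f' (axis i \<i>)) / 2"
  unfolding dz_def dzbar_def using frechet_derivative_at by metis+

lemma
  assumes "f differentiable (at z)" "g differentiable (at z)"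
  shows dz_diff: "dz i (\<lambda>w. f w - g w) z = dz i f z - dz i g z"
    and dzbar_diff: "dzbar i (\<lambda>w. f w - g w) z = dzbar i f z - dzbar i g z"
    and dz_mult: "dz i (\<lambda>w. f w * g w) z = dz i f z * g z + f z * dz i g z"
    and dzbar_mult: "dzbar i (\<lambda>w. f w * g w) z = dzbar i f z * g z + f z * dzbar i g z"
proof -
  note D = assms[unfolded frechet_derivative_works]
  show "dz i (\<lambda>w. f w - g w) z = dz i f z - dz i g z"
    "dzbar i (\<lambda>w. f w - g w) z = dzbar i f z - dzbar i g z"
    unfolding dz_eq[OF has_derivative_diff[OF D]] dzbar_eq[OF has_derivative_diff[OF D]]
    by (simp_all add: dz_def dzbar_def field_simps)
  show "dz i (\<lambda>w. f w * g w) z = dz i f z * g z + f z * dz i g z"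
    "dzbar i (\<lambda>w. f w * g w) z = dzbar i f z * g z + f z * dzbar i g z"
    unfolding dz_eq[OF has_derivative_mult[OF D]] dzbar_eq[OF has_derivative_mult[OF D]]
    by (simp_all add: dz_def dzbar_def field_simps)
qed

lemma
  assumes "\<And>a. a \<in> A \<Longrightarrow> f a differentiable (at z)"
  shows dz_sum: "dz i (\<lambda>w. \<Sum>a\<in>A. f a w) z = (\<Sum>a\<in>A. dz i (f a) z)"
    and dzbar_sum: "dzbar i (\<lambda>w. \<Sum>a\<in>A. f a w) z = (\<Sum>a\<in>A. dzbar i (f a) z)"
proof -
  have D: "((\<lambda>w. \<Sum>a\<in>A. f a w) has_derivative (\<lambda>v. \<Sum>a\<in>A. frechet_derivative (f a) (at z) v)) (at z)"
    using assms by (intro has_derivative_sum) (simp add: frechet_derivative_works[symmetric])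
  show "dz i (\<lambda>w. \<Sum>a\<in>A. f a w) z = (\<Sum>a\<in>A. dz i (f a) z)"
    "dzbar i (\<lambda>w. \<Sum>a\<in>A. f a w) z = (\<Sum>a\<in>A. dzbar i (f a) z)"
    unfolding dz_eq[OF D] dzbar_eq[OF D]
    by (simp_all add: dz_def dzbar_def sum_subtractf sum.distrib sum_distrib_left
        sum_divide_distrib diff_divide_distrib add_divide_distrib)
qed

text \<open>Conjugation is real linear, so it passes through the real derivative, but it flips the
  sign of \<open>\<i>\<close>, which exchanges the two operators.\<close>

lemma dz_cnj: "f differentiable (at z) \<Longrightarrow> dz i (\<lambda>w. cnj (f w)) z = cnj (dzbar i f z)"
  by (simp add: dz_eq[OF has_derivative_cnj] dzbar_def frechet_derivative_works)

text \<open>Identities involving the inverse metric hold only on the chart image; this allows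
  differentiating them at its points.\<close>

lemma
  assumes "open S" "z \<in> S" "\<And>x. x \<in> S \<Longrightarrow> f x = g x" "g differentiable (at z)"
  shows dz_cong: "dz i f z = dz i g z" and dzbar_cong: "dzbar i f z = dzbar i g z"
proof -
  have "(f has_derivative frechet_derivative g (at z)) (at z)"
    using assms has_derivative_transform_within_open[of g _ z UNIV S f]
    by (simp add: frechet_derivative_works)
  from dz_eq[OF this] dzbar_eq[OF this]
  show "dz i f z = dz i g z" "dzbar i f z = dzbar i g z"
    by (simp_all add: dz_def dzbar_def)
qed

lemma
  assumes "Ck_on 2 f S" "z \<in> S"
  shows dz_has_derivative: "(dz k f has_derivative
      (\<lambda>v. (frechet_derivative (\<lambda>y. frechet_derivative f (at y) (axis k 1)) (at z) v
       - \<i> * frechet_derivative (\<lambda>y. frechet_derivative f (at y) (axis k \<i>)) (at z) v) / 2)) (at z)"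
    and dzbar_has_derivative: "(dzbar k f has_derivative
      (\<lambda>v. (frechet_derivative (\<lambda>y. frechet_derivative f (at y) (axis k 1)) (at z) v
       + \<i> * frechet_derivative (\<lambda>y. frechet_derivative f (at y) (axis k \<i>)) (at z) v) / 2)) (at z)"
  unfolding dz_def dzbar_def divide_inverse
  by (intro has_derivative_mult_left has_derivative_mult_right has_derivative_diff
      has_derivative_add Ck_on_2D(2)[OF assms])+

lemma dz_dzbar_commute:
  assumes "open S" "Ck_on 2 f S" "z \<in> S"
  shows "dz k (dzbar l f) z = dzbar l (dz k f) z"
proof -
  have "frechet_derivative (\<lambda>y. frechet_derivative f (at y) u) (at z) v
      = frechet_derivative (\<lambda>y. frechet_derivative f (at y) v) (at z) u" for u v
    by (rule second_derivative_symmetric[OF assms(1,3)]) (fact Ck_on_2D[OF assms(2)])+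
  \<comment> \<open>Fixing the inner direction to the \<open>l\<close>-axis orients the rewriting:
    inner \<open>l\<close> with outer \<open>k\<close> becomes inner \<open>k\<close> with outer
    \<open>l\<close>, so both sides reach one form and the rule does not loop.\<close>
  note sym = this[of "axis l _"]
  show ?thesis
    unfolding dz_eq[OF dzbar_has_derivative[OF assms(2,3)]]
      dzbar_eq[OF dz_has_derivative[OF assms(2,3)]] sym
    by (simp add: field_simps)
qed

section \<open>Differentiability of the inverse matrix\<close>

text \<open>If \<open>H *v v = 0\<close>, the form vanishes at the conjugate of \<open>v\<close>, so
  positivity forces a trivial kernel. The conjugate is taken because the form conjugates its second
  argument, while \<open>H *v v\<close> sums over the second index without conjugation.\<close>

lemma positive_hermitian_invertible:
  assumes "positive_hermitian H"
  shows "invertible H"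
proof -
  have "v = 0" if v: "H *v v = 0" for v
  proof (rule ccontr)
    assume "v \<noteq> 0"
    then have "(\<chi> i. cnj (v $ i)) \<noteq> 0" by (auto simp: vec_eq_iff)
    with assms have "Re (\<Sum>i\<in>UNIV. \<Sum>j\<in>UNIV. H $ i $ j * (\<chi> i. cnj (v $ i)) $ i
        * cnj ((\<chi> i. cnj (v $ i)) $ j)) > 0"
      unfolding positive_hermitian_def by blast
    then have "Re (\<Sum>i\<in>UNIV. \<Sum>j\<in>UNIV. H $ i $ j * cnj (v $ i) * v $ j) > 0"
      by simp
    moreover have "(\<Sum>j\<in>UNIV. H $ i $ j * cnj (v $ i) * v $ j) = cnj (v $ i) * (H *v v) $ i" for i
      by (simp add: matrix_vector_mult_def sum_distrib_left mult_ac)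
    ultimately show False using v by simp
  qed
  then show ?thesis
    using matrix_left_invertible_ker matrix_left_right_inverse invertible_def by blast
qed

lemma matrix_inv_mult:
  fixes A :: "'a::field^'n^'n"
  assumes "invertible A"
  shows "A ** matrix_inv A = mat 1" "matrix_inv A ** A = mat 1"
  using someI_ex[OF assms[unfolded invertible_def]] unfolding matrix_inv_def by auto

text \<open>Column \<open>j\<close> of the inverse solves \<open>A *v x = axis j 1\<close>, so
  Cramer's rule applies. Entries become quotients of polynomials in the entries of \<open>A\<close>,
  which reduces differentiability of the inverse to that of determinants.\<close>

lemma matrix_inv_cramer:
  fixes A :: "'a::field^'n^'n"
  assumes "invertible A"
  shows "matrix_inv A $ m $ j = det (\<chi> a b. if b = m then axis j 1 $ a else A $ a $ b) / det A"
proof -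
  have "A *v (matrix_inv A *v axis j 1) = axis j 1"
    by (simp add: matrix_vector_mul_assoc matrix_inv_mult[OF assms])
  then have "matrix_inv A *v axis j 1
      = (\<chi> m. det (\<chi> a b. if b = m then axis j 1 $ a else A $ a $ b) / det A)"
    using cramer[of A] assms by (simp add: invertible_det_nz)
  moreover have "(matrix_inv A *v axis j 1) $ m = matrix_inv A $ m $ j"
    by (simp add: matrix_vector_mult_def axis_def if_distrib[of "(*) _"] cong: if_cong)
  ultimately show ?thesis by simp
qed

lemma differentiable_prod:
  fixes f :: "'i \<Rightarrow> 'a::real_normed_vector \<Rightarrow> 'b::real_normed_field"
  assumes "\<And>i. i \<in> I \<Longrightarrow> f i differentiable (at x)"
  shows "(\<lambda>x. \<Prod>i\<in>I. f i x) differentiable (at x)"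
  by (rule differentiableI, rule has_derivative_prod)
     (use assms in \<open>simp add: frechet_derivative_works\<close>)

lemma differentiable_det:
  fixes A :: "'a::real_normed_vector \<Rightarrow> 'b::real_normed_field^'n^'n"
  assumes "\<And>a b. (\<lambda>x. A x $ a $ b) differentiable (at x)"
  shows "(\<lambda>x. det (A x)) differentiable (at x)"
  unfolding det_def
  by (auto intro!: differentiable_sum differentiable_mult differentiable_prod assms
      simp: finite_permutations)

lemma differentiable_matrix_inv:
  fixes A :: "'a::real_normed_vector \<Rightarrow> 'b::real_normed_field^'n^'n"
  assumes "\<And>a b. (\<lambda>x. A x $ a $ b) differentiable (at x)"
    and "open S" "x \<in> S" "\<And>x. x \<in> S \<Longrightarrow> invertible (A x)"
  shows "(\<lambda>x. matrix_inv (A x) $ m $ j) differentiable (at x)"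
proof -
  have "(\<lambda>x. det (\<chi> a b. if b = m then axis j 1 $ a else A x $ a $ b) / det (A x))
      differentiable (at x)"
  proof (intro differentiable_divide differentiable_det assms(1))
    show "(\<lambda>x. (\<chi> a b. if b = m then axis j 1 $ a else A x $ a $ b) $ a $ b) differentiable (at x)"
      for a b by (cases "b = m") (simp_all add: assms(1))
    show "det (A x) \<noteq> 0" using assms(3,4) invertible_det_nz by blast
  qed
  then obtain D where
    "((\<lambda>x. det (\<chi> a b. if b = m then axis j 1 $ a else A x $ a $ b) / det (A x)) has_derivative D) (at x)"
    unfolding differentiable_def by blast
  then have "((\<lambda>x. matrix_inv (A x) $ m $ j) has_derivative D) (at x)"
    by (rule has_derivative_transform_within_open[OF _ assms(2,3)])
       (simp add: matrix_inv_cramer assms(4))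
  then show ?thesis by (rule differentiableI)
qed

section \<open>Curvature in coordinates\<close>

text \<open>The claim concerns a single chart, with \<open>S\<close> as its image. Order 2 matches
  the second derivatives of the metric that enter the curvature.\<close>

locale local_metric =
  fixes g :: "'n::finite metric_coeffs" and S :: "(complex^'n) set"
  assumes open_S: "open S" and Ck2: "Ck_on 2 g S"
    and pos: "\<And>z. z \<in> S \<Longrightarrow> positive_hermitian (g z)"
begin

abbreviation G :: "'n \<Rightarrow> 'n \<Rightarrow> complex^'n \<Rightarrow> complex" where
  "G a b \<equiv> \<lambda>w. g w $ a $ b"

lemma Ck2_G: "Ck_on 2 (G a b) S"
  by (intro Ck_on_bounded_linear[OF open_S _ Ck2]
      bounded_linear_compose[OF bounded_linear_vec_nth bounded_linear_vec_nth])

lemma G_cnj: "w \<in> S \<Longrightarrow> G a b w = cnj (G b a w)"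
  using pos unfolding positive_hermitian_def by blast

section \<open>Lowering indices\<close>

lemma invertible_g: "w \<in> S \<Longrightarrow> invertible (g w)"
  using pos positive_hermitian_invertible by blast

lemma g_inv_contract:
  assumes "w \<in> S"
  shows "(\<Sum>m\<in>UNIV. g w $ m $ l * g_inv g m n w) = (if n = l then 1 else 0)"
proof -
  have "(matrix_inv (g w) ** g w) $ n $ l = (mat 1 :: complex^'n^'n) $ n $ l"
    by (simp add: matrix_inv_mult invertible_g assms)
  then show ?thesis by (simp add: matrix_matrix_mult_def g_inv_def mat_def mult.commute)
qed

text \<open>Both \<open>chern_Gamma\<close> and \<open>bismut_Abar\<close> are of the form
  \<open>g_inv\<close> contracted with some \<open>X\<close>; lowering them recovers
  \<open>X\<close> and removes the inverse matrix.\<close>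

lemma lower_raised:
  assumes "w \<in> S"
  shows "(\<Sum>m\<in>UNIV. g w $ m $ l * (\<Sum>n\<in>UNIV. g_inv g m n w * X n)) = X l"
proof -
  have "(\<Sum>m\<in>UNIV. g w $ m $ l * (\<Sum>n\<in>UNIV. g_inv g m n w * X n))
      = (\<Sum>n\<in>UNIV. (\<Sum>m\<in>UNIV. g w $ m $ l * g_inv g m n w) * X n)"
    unfolding sum_distrib_left sum_distrib_right
    by (subst sum.swap) (simp add: mult.assoc)
  also have "\<dots> = X l"
    by (simp add: g_inv_contract[OF assms] if_distrib[of "\<lambda>t. t * _"] cong: if_cong)
  finally show ?thesis .
qed

lemma chern_Gamma_low: "w \<in> S \<Longrightarrow> (\<Sum>m\<in>UNIV. G m l w * chern_Gamma g i k m w) = dz i (G k l) w"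
  unfolding chern_Gamma_def by (rule lower_raised)

lemma torsion_low_eq: "w \<in> S \<Longrightarrow> torsion_low g i j k w = dz i (G j k) w - dz j (G i k) w"
  by (simp add: torsion_low_def torsion_def right_diff_distrib sum_subtractf chern_Gamma_low)

section \<open>Differentiability of the connection coefficients\<close>

lemma differentiable_G: "w \<in> S \<Longrightarrow> G a b differentiable (at w)"
  using Ck_on_2D(1)[OF Ck2_G] differentiableI by blast

lemma differentiable_dz_G: "w \<in> S \<Longrightarrow> dz i (G a b) differentiable (at w)"
  and differentiable_dzbar_G: "w \<in> S \<Longrightarrow> dzbar i (G a b) differentiable (at w)"
  using dz_has_derivative[OF Ck2_G] dzbar_has_derivative[OF Ck2_G] differentiableI by blast+

lemma differentiable_g_inv: "w \<in> S \<Longrightarrow> g_inv g i j differentiable (at w)"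
  unfolding g_inv_def
  by (rule differentiable_matrix_inv[OF differentiable_G open_S]) (auto simp: invertible_g)

lemma differentiable_chern_Gamma: "w \<in> S \<Longrightarrow> chern_Gamma g i j k differentiable (at w)"
  unfolding chern_Gamma_def
  by (auto intro!: differentiable_sum differentiable_mult differentiable_g_inv differentiable_dz_G)

text \<open>Conjugation turns \<open>dz\<close> into \<open>dzbar\<close>, and Hermitian symmetry of
  the metric absorbs the remaining conjugate by swapping the indices of \<open>G\<close>.\<close>

lemma cnj_torsion_low_eq:
  assumes "w \<in> S"
  shows "cnj (torsion_low g i j k w) = dzbar i (G k j) w - dzbar j (G k i) w"
proof -
  have "dz i (G j k) w = cnj (dzbar i (G k j) w)" for i j
  proof -
    have "(\<lambda>w. cnj (G k j w)) differentiable (at w)"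
      using has_derivative_cnj[OF Ck_on_2D(1)[OF Ck2_G assms]] by (rule differentiableI)
    from dz_cong[OF open_S assms G_cnj this] show ?thesis
      by (simp only: dz_cnj[OF differentiable_G[OF assms]])
  qed
  then show ?thesis by (simp add: torsion_low_eq[OF assms])
qed

lemma bismut_Abar_low:
  "w \<in> S \<Longrightarrow> (\<Sum>m\<in>UNIV. G m j w * bismut_Abar g l i m w) = dzbar l (G i j) w - dzbar j (G i l) w"
  unfolding bismut_Abar_def by (simp add: lower_raised cnj_torsion_low_eq)

lemma differentiable_bismut_Abar:
  assumes "w \<in> S" shows "bismut_Abar g i l j differentiable (at w)"
proof -
  have "(\<lambda>w. \<Sum>m\<in>UNIV. g_inv g j m w * (dzbar i (G l m) w - dzbar m (G l i) w)) differentiable (at w)"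
    using assms by (auto intro!: differentiable_sum differentiable_mult differentiable_g_inv
        differentiable_diff differentiable_dzbar_G)
  then obtain D where "((\<lambda>w. \<Sum>m\<in>UNIV. g_inv g j m w * (dzbar i (G l m) w - dzbar m (G l i) w))
      has_derivative D) (at w)"
    by (auto simp: differentiable_def)
  then have "(bismut_Abar g i l j has_derivative D) (at w)"
    by (rule has_derivative_transform_within_open[OF _ open_S assms])
       (simp add: bismut_Abar_def cnj_torsion_low_eq)
  then show ?thesis by (rule differentiableI)
qed

section \<open>Derivatives of the lowered coefficients\<close>

lemma dzbar_chern_Gamma_low:
  assumes "z \<in> S"
  shows "(\<Sum>m\<in>UNIV. G m l z * dzbar j (chern_Gamma g i k m) z)
    = dzbar j (dz i (G k l)) z - (\<Sum>m\<in>UNIV. dzbar j (G m l) z * chern_Gamma g i k m z)"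
proof -
  note d = differentiable_G[OF assms] differentiable_chern_Gamma[OF assms]
  have "dzbar j (dz i (G k l)) z = dzbar j (\<lambda>w. \<Sum>m\<in>UNIV. G m l w * chern_Gamma g i k m w) z"
    by (rule dzbar_cong[OF open_S assms]) (simp_all add: chern_Gamma_low d)
  \<comment> \<open>The product rule for the lowered coefficient; solving for the term with the
    differentiated \<open>chern_Gamma\<close> avoids differentiating \<open>g_inv\<close>.\<close>
  also have "\<dots> = (\<Sum>m\<in>UNIV. dzbar j (G m l) z * chern_Gamma g i k m z
      + G m l z * dzbar j (chern_Gamma g i k m) z)"
    by (simp add: dzbar_sum dzbar_mult d)
  finally show ?thesis by (simp add: sum.distrib)
qed

lemma dz_bismut_Abar_low:
  assumes "z \<in> S"
  shows "(\<Sum>m\<in>UNIV. G m j z * dz k (bismut_Abar g l i m) z)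
    = dz k (dzbar l (G i j)) z - dz k (dzbar j (G i l)) z
      - (\<Sum>m\<in>UNIV. dz k (G m j) z * bismut_Abar g l i m z)"
proof -
  note d = differentiable_G[OF assms] differentiable_bismut_Abar[OF assms]
    differentiable_dzbar_G[OF assms]
  have "dz k (\<lambda>w. dzbar l (G i j) w - dzbar j (G i l) w) z
      = dz k (\<lambda>w. \<Sum>m\<in>UNIV. G m j w * bismut_Abar g l i m w) z"
    by (rule dz_cong[OF open_S assms]) (simp_all add: bismut_Abar_low d)
  also have "\<dots> = (\<Sum>m\<in>UNIV. dz k (G m j) z * bismut_Abar g l i m z
      + G m j z * dz k (bismut_Abar g l i m) z)"
    by (simp add: dz_sum dz_mult d)
  finally show ?thesis by (simp add: sum.distrib dz_diff d)
qed

lemma dzbar_torsion_low: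
  assumes "z \<in> S"
  shows "dzbar l (torsion_low g i k j) z = dzbar l (dz i (G k j)) z - dzbar l (dz k (G i j)) z"
proof -
  note d = differentiable_dz_G[OF assms]
  show ?thesis
    using dzbar_cong[OF open_S assms torsion_low_eq differentiable_diff[OF d d]]
    by (simp add: dzbar_diff[OF d d])
qed

section \<open>The lowered curvature tensors and \<open>Q\<close>\<close>

lemma chern_curv_low_eq:
  "z \<in> S \<Longrightarrow> chern_curv_low g i j k l z =
    (\<Sum>m\<in>UNIV. dzbar j (G m l) z * chern_Gamma g i k m z) - dzbar j (dz i (G k l)) z"
  by (simp add: chern_curv_low_def chern_curv_def sum_negf dzbar_chern_Gamma_low)

text \<open>The sum over \<open>q\<close> is by definition \<open>bismut_Abar g l i p\<close>, and
  the other torsion factor splits into two first derivatives of \<open>G\<close>.\<close>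

lemma torsion_square:
  assumes "z \<in> S"
  shows "(\<Sum>p\<in>UNIV. \<Sum>q\<in>UNIV. g_inv g p q z * torsion_low g k p j z * cnj (torsion_low g l q i z))
    = (\<Sum>m\<in>UNIV. dz k (G m j) z * bismut_Abar g l i m z) - (\<Sum>m\<in>UNIV. dz m (G k j) z * bismut_Abar g l i m z)"
proof -
  have "(\<Sum>q\<in>UNIV. g_inv g p q z * torsion_low g k p j z * cnj (torsion_low g l q i z))
      = (dz k (G p j) z - dz p (G k j) z) * bismut_Abar g l i p z" for p
    unfolding torsion_low_eq[OF assms, symmetric]
    by (simp add: bismut_Abar_def sum_distrib_left mult_ac)
  then show ?thesis by (simp add: left_diff_distrib sum_subtractf)
qed

lemma lower_contracted:
  "(\<Sum>m\<in>UNIV. G m j z * (\<Sum>s\<in>UNIV. X s m * Y s)) = (\<Sum>s\<in>UNIV. (\<Sum>m\<in>UNIV. G m j z * X s m) * Y s)"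
  unfolding sum_distrib_left sum_distrib_right
  by (subst sum.swap) (simp add: mult.assoc)

lemma bismut_curv_low_eq:
  assumes "z \<in> S"
  shows "bismut_curv_low g k l i j z =
      dz k (dzbar l (G i j)) z - dz k (dzbar j (G i l)) z - dzbar l (dz i (G k j)) z
      - (\<Sum>m\<in>UNIV. dz k (G m j) z * bismut_Abar g l i m z)
      + (\<Sum>m\<in>UNIV. dz m (G k j) z * bismut_Abar g l i m z)
      + (\<Sum>m\<in>UNIV. dzbar j (G m l) z * chern_Gamma g i k m z)"
proof -
  have "bismut_curv_low g k l i j z =
      (\<Sum>m\<in>UNIV. G m j z * dz k (bismut_Abar g l i m) z)
      - (\<Sum>m\<in>UNIV. G m j z * dzbar l (chern_Gamma g i k m) z)
      + (\<Sum>m\<in>UNIV. G m j z * (\<Sum>s\<in>UNIV. chern_Gamma g s k m z * bismut_Abar g l i s z))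
      - (\<Sum>m\<in>UNIV. G m j z * (\<Sum>s\<in>UNIV. bismut_Abar g l s m z * chern_Gamma g i k s z))"
    unfolding bismut_curv_low_def bismut_curv_def curv11_def bismut_A_def
    by (simp add: distrib_left right_diff_distrib sum.distrib sum_subtractf)
  \<comment> \<open>The product rule for \<open>chern_Gamma\<close> yields
    \<open>dzbar l (G m j) z * chern_Gamma g i k m z\<close>; lowering the last quadratic term
    yields its negative, so only the part with \<open>dzbar j (G m l)\<close> survives.\<close>
  then show ?thesis
    using assms by (simp add: dz_bismut_Abar_low dzbar_chern_Gamma_low lower_contracted
        chern_Gamma_low bismut_Abar_low left_diff_distrib sum_subtractf)
qed

text \<open>The product terms agree on both sides. After commuting \<open>dz k\<close> with
  \<open>dzbar l\<close> and \<open>dzbar j\<close>, the torsion derivatives cancel all second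
  derivatives in the Bismut curvature and leave \<open>- dzbar j (dz i (G k l)) z\<close>, the one
  in the Chern curvature.\<close>

lemma Q_tensor_eq:
  assumes "z \<in> S"
  shows "Q_tensor g i j k l z = bismut_curv_low g k l i j z
    + dzbar l (torsion_low g i k j) z - dzbar j (torsion_low g i k l) z"
  using dz_dzbar_commute[OF open_S Ck2_G assms]
  by (simp add: Q_tensor_def chern_curv_low_eq torsion_square bismut_curv_low_eq
      dzbar_torsion_low assms)

end

theorem proposition2p3:
  fixes \<A> :: "('p::{t2_space,second_countable_topology}, 'n::finite) chart set"
    and g :: "('p, 'n) chart \<Rightarrow> complex^'n \<Rightarrow> complex^'n^'n"
    and U :: "'p set" and \<phi> :: "'p \<Rightarrow> complex^'n" and z :: "complex^'n"
    and i j k l :: 'n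
  assumes "hermitian_manifold \<A> g"
    and "(U, \<phi>) \<in> \<A>"
    and "z \<in> \<phi> ` U"
  shows "Q_tensor (g (U, \<phi>)) i j k l z =
           bismut_curv_low (g (U, \<phi>)) k l i j z
           + dzbar l (torsion_low (g (U, \<phi>)) i k j) z
           - dzbar j (torsion_low (g (U, \<phi>)) i k l) z"
proof -
  have "complex_manifold \<A>" "hermitian_metric \<A> g"
    using assms(1) by (auto simp: hermitian_manifold_def)
  then have "open (\<phi> ` U)" "smooth_on (g (U, \<phi>)) (\<phi> ` U)"
    "\<And>z. z \<in> \<phi> ` U \<Longrightarrow> positive_hermitian (g (U, \<phi>) z)"
    using assms(2) by (fastforce simp: complex_manifold_def hermitian_metric_def)+
  then interpret local_metric "g (U, \<phi>)" "\<phi> ` U"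
    by unfold_locales (auto simp: smooth_on_def)
  show ?thesis using assms(3) by (rule Q_tensor_eq)
qed

end
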